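(* For every $n\ge1$ and $1\le r\le n$, the number $N_{r,n}$ of loopfree nested matroids of rank $r$ on the labeled ground set $[n]$ equals the Eulerian number $A_{r-1,n}$.
   Context: A matroid is nested if its set of cyclic flats (flats that are unions of circuits) is totally ordered by inclusion. Matroids are counted on the labeled ground set, not up to isomorphism. The Eulerian number $A_{r,n}$ is the number of permutations $\sigma$ of $\{1,\dots,n\}$ with exactly $r$ ascents, an ascent being an $i\in\{1,\dots,n-1\}$ with $\sigma(i)<\sigma(i+1)$. *)

theory Defs
  imports "HOL-Combinatorics.Permutations"
begin

text \<open>A matroid is given by its ground set \<open>E\<close> and its family \<open>I\<close> of independent sets. Two labeled
  matroids on the same ground set are thus equal iff their families of independent sets are.\<close>

definition matroid :: "'a set \<Rightarrow> 'a set set \<Rightarrow> bool" where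
  "matroid E I \<longleftrightarrow>
     finite E \<and> I \<subseteq> Pow E \<and> {} \<in> I \<and>
     (\<forall>X\<in>I. \<forall>Y. Y \<subseteq> X \<longrightarrow> Y \<in> I) \<and>
     (\<forall>X\<in>I. \<forall>Y\<in>I. card X < card Y \<longrightarrow> (\<exists>y\<in>Y - X. insert y X \<in> I))"

definition circuit :: "'a set \<Rightarrow> 'a set set \<Rightarrow> 'a set \<Rightarrow> bool" where
  "circuit E I C \<longleftrightarrow> C \<subseteq> E \<and> C \<notin> I \<and> (\<forall>D. D \<subset> C \<longrightarrow> D \<in> I)"

definition rank_of :: "'a set set \<Rightarrow> 'a set \<Rightarrow> nat" where
  "rank_of I X = Max (card ` {Y \<in> I. Y \<subseteq> X})"

definition flat :: "'a set \<Rightarrow> 'a set set \<Rightarrow> 'a set \<Rightarrow> bool" where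
  "flat E I F \<longleftrightarrow> F \<subseteq> E \<and> (\<forall>e\<in>E - F. rank_of I F < rank_of I (insert e F))"

text \<open>The family of circuits may be empty, so the empty set is a cyclic flat whenever it is a flat.\<close>

definition cyclic_flat :: "'a set \<Rightarrow> 'a set set \<Rightarrow> 'a set \<Rightarrow> bool" where
  "cyclic_flat E I F \<longleftrightarrow> flat E I F \<and> (\<exists>\<C>. (\<forall>C\<in>\<C>. circuit E I C) \<and> F = \<Union>\<C>)"

definition nested_matroid :: "'a set \<Rightarrow> 'a set set \<Rightarrow> bool" where
  "nested_matroid E I \<longleftrightarrow>
     matroid E I \<and> (\<forall>F G. cyclic_flat E I F \<longrightarrow> cyclic_flat E I G \<longrightarrow> F \<subseteq> G \<or> G \<subseteq> F)"

definition loopfree :: "'a set \<Rightarrow> 'a set set \<Rightarrow> bool" where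
  "loopfree E I \<longleftrightarrow> (\<forall>e\<in>E. \<not> circuit E I {e})"

definition num_loopfree_nested :: "nat \<Rightarrow> nat \<Rightarrow> nat" where
  "num_loopfree_nested r n =
     card {I. nested_matroid {1..n} I \<and> loopfree {1..n} I \<and> rank_of I {1..n} = r}"

definition ascents :: "nat \<Rightarrow> (nat \<Rightarrow> nat) \<Rightarrow> nat set" where
  "ascents n \<sigma> = {i \<in> {1..<n}. \<sigma> i < \<sigma> (i + 1)}"

definition eulerian :: "nat \<Rightarrow> nat \<Rightarrow> nat" where
  "eulerian r n = card {\<sigma>. \<sigma> permutes {1..n} \<and> card (ascents n \<sigma>) = r}"

end

theory Submission
  imports
    Defs
    "HOL-Combinatorics.Multiset_Permutations"
    "HOL-Computational_Algebra.Formal_Power_Series"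
begin

unbundle fps_syntax

text \<open>
  A loopfree nested matroid is determined by the set of pairs (cyclic flat, rank). These sets are
  exactly the chains starting at \<open>({}, 0)\<close> in which \<open>0 < r H - r F < |H - F|\<close> for all \<open>F \<subset> H\<close>; the
  independent sets are the \<open>X\<close> with \<open>|X \<inter> F| \<le> r F\<close> for all cyclic flats \<open>F\<close>. Building a chain from its
  largest member gives, with \<open>t\<close> marking the rank, the exponential generating function
  \<open>e\<^sup>t\<^sup>x / (1 - G)\<close>, where \<open>G = \<Sum>s. (t + \<dots> + t\<^sup>s\<^sup>-\<^sup>1) x\<^sup>s / s!\<close>. Splitting increasing prefixes off a
  permutation, with \<open>t\<close> marking ascents, gives \<open>1 / (1 - K)\<close>, where
  \<open>K = \<Sum>s\<ge>1. (t - 1)\<^sup>s\<^sup>-\<^sup>1 x\<^sup>s / s!\<close>. In closed form both are quotients of exponentials, and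
  \<open>e\<^sup>t\<^sup>x / (1 - G) = 1 - t + t / (1 - K)\<close> for \<open>t \<noteq> 1\<close>.
\<close>

subsection \<open>Rank, circuits and cyclic flats\<close>

lemma card_le_rank_of:
  assumes "matroid E I" "Y \<in> I" "Y \<subseteq> X"
  shows "card Y \<le> rank_of I X"
proof -
  have "finite I" using assms(1) unfolding matroid_def by (meson finite_Pow_iff finite_subset)
  then show ?thesis unfolding rank_of_def using assms by (intro Max_ge) auto
qed

lemma ex_card_eq_rank_of:
  assumes "matroid E I"
  shows "\<exists>Y\<in>I. Y \<subseteq> X \<and> card Y = rank_of I X"
proof -
  have "finite I" using assms unfolding matroid_def by (meson finite_Pow_iff finite_subset)
  moreover have "{} \<in> I" using assms unfolding matroid_def by auto
  ultimately have "rank_of I X \<in> card ` {Y \<in> I. Y \<subseteq> X}"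
    unfolding rank_of_def by (intro Max_in) auto
  then show ?thesis by auto
qed

lemma rank_of_eqI:
  assumes "matroid E I" "Y \<in> I" "Y \<subseteq> X" "\<And>W. W \<in> I \<Longrightarrow> W \<subseteq> X \<Longrightarrow> card W \<le> card Y"
  shows "rank_of I X = card Y"
  by (metis assms card_le_rank_of ex_card_eq_rank_of le_antisym)

lemma rank_of_mono:
  assumes "matroid E I" "X \<subseteq> X'"
  shows "rank_of I X \<le> rank_of I X'"
  by (metis assms card_le_rank_of ex_card_eq_rank_of subset_trans)

lemma indep_subset: "matroid E I \<Longrightarrow> X \<in> I \<Longrightarrow> Y \<subseteq> X \<Longrightarrow> Y \<in> I"
  unfolding matroid_def by blast

lemma indep_finite: "matroid E I \<Longrightarrow> X \<in> I \<Longrightarrow> finite X"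
  unfolding matroid_def by (meson PowD finite_subset subsetD)

lemma matroid_finite_subset: "matroid E I \<Longrightarrow> X \<subseteq> E \<Longrightarrow> finite X"
  unfolding matroid_def by (meson finite_subset)

lemma indep_augment:
  "matroid E I \<Longrightarrow> X \<in> I \<Longrightarrow> Y \<in> I \<Longrightarrow> card X < card Y \<Longrightarrow> \<exists>y\<in>Y - X. insert y X \<in> I"
  unfolding matroid_def by blast

lemma indep_extend:
  assumes m: "matroid E I" and X: "X \<in> I" "X \<subseteq> S"
  shows "\<exists>Y\<in>I. X \<subseteq> Y \<and> Y \<subseteq> S \<and> card Y = rank_of I S"
  \<comment> \<open>The deficiency \<open>rank_of I S - card X\<close> drops by one with each
    element borrowed from a maximum independent subset of \<open>S\<close>, so \<open>X\<close>
    never leaves \<open>S\<close>.\<close>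
  using X
proof (induction "rank_of I S - card X" arbitrary: X)
  case 0
  then show ?case by (metis card_le_rank_of diff_is_0_eq le_antisym m order_refl)
next
  case (Suc k)
  obtain Y where Y: "Y \<in> I" "Y \<subseteq> S" "card Y = rank_of I S"
    using ex_card_eq_rank_of[OF m] by blast
  then have "card X < card Y" using Suc.hyps(2) by simp
  then obtain y where y: "y \<in> Y - X" "insert y X \<in> I"
    using indep_augment[OF m] Suc.prems Y by blast
  have "k = rank_of I S - card (insert y X)"
    using Suc.hyps(2) y indep_finite[OF m Suc.prems(1)] by simp
  from Suc.hyps(1)[OF this y(2)] show ?case using y Y Suc.prems by blast
qed

lemma ex_circuit:
  assumes "matroid E I" "X \<subseteq> E" "X \<notin> I"
  shows "\<exists>C\<subseteq>X. circuit E I C"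
proof -
  have "finite X" using matroid_finite_subset[OF assms(1,2)] .
  then show ?thesis using assms(2,3)
  proof (induction X rule: finite_psubset_induct)
    case (psubset X)
    show ?case
    proof (cases "\<forall>D. D \<subset> X \<longrightarrow> D \<in> I")
      case True
      then show ?thesis using psubset.prems unfolding circuit_def by blast
    next
      case False
      then obtain D where "D \<subset> X" "D \<notin> I" by blast
      then have "\<exists>C\<subseteq>D. circuit E I C" using psubset by blast
      then show ?thesis using \<open>D \<subset> X\<close> by blast
    qed
  qed
qed

lemma circuit_minus_indep: "circuit E I C \<Longrightarrow> c \<in> C \<Longrightarrow> C - {c} \<in> I"
  unfolding circuit_def by blast

lemma ex_circuit_insert:
  assumes m: "matroid E I" and "X \<in> I" "e \<in> E" "insert e X \<notin> I"
  shows "\<exists>C. circuit E I C \<and> e \<in> C \<and> C \<subseteq> insert e X"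
proof -
  have "X \<subseteq> E" using m \<open>X \<in> I\<close> unfolding matroid_def by blast
  then obtain C where C: "C \<subseteq> insert e X" "circuit E I C"
    using ex_circuit[OF m, of "insert e X"] assms by blast
  have "e \<in> C"
  proof (rule ccontr)
    assume "e \<notin> C"
    then have "C \<subseteq> X" using C by blast
    then show False using indep_subset[OF m \<open>X \<in> I\<close>] C(2) unfolding circuit_def by blast
  qed
  then show ?thesis using C by blast
qed

text \<open>A pointwise form that is easier to use: the family of all circuits inside
  \<open>F\<close> serves as the covering family.\<close>

lemma cyclic_flat_alt:
  "cyclic_flat E I F \<longleftrightarrow> flat E I F \<and> (\<forall>e\<in>F. \<exists>C. circuit E I C \<and> e \<in> C \<and> C \<subseteq> F)"
  (is "_ \<longleftrightarrow> _ \<and> ?R")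
proof -
  have "(\<exists>\<C>. (\<forall>C\<in>\<C>. circuit E I C) \<and> F = \<Union>\<C>) \<longleftrightarrow> ?R"
  proof
    assume R: ?R
    show "\<exists>\<C>. (\<forall>C\<in>\<C>. circuit E I C) \<and> F = \<Union>\<C>"
      by (rule exI[of _ "{C. circuit E I C \<and> C \<subseteq> F}"]) (use R in auto)
  next
    assume "\<exists>\<C>. (\<forall>C\<in>\<C>. circuit E I C) \<and> F = \<Union>\<C>"
    then obtain \<C> where C: "\<forall>C\<in>\<C>. circuit E I C" "F = \<Union>\<C>" by blast
    show ?R
    proof
      fix e assume "e \<in> F"
      then obtain C where "C \<in> \<C>" "e \<in> C" using C(2) by blast
      then show "\<exists>C. circuit E I C \<and> e \<in> C \<and> C \<subseteq> F" using C by (intro exI[of _ C]) auto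
    qed
  qed
  then show ?thesis unfolding cyclic_flat_def by simp
qed

text \<open>The closure of a circuit is a cyclic flat whose rank is \<open>card C - 1\<close>. It is
  therefore a witness, among the cyclic flats, that a set containing \<open>C\<close> is
  dependent.\<close>

lemma circuit_closure:
  assumes m: "matroid E I" and C: "circuit E I C"
  shows "\<exists>F. cyclic_flat E I F \<and> C \<subseteq> F \<and> rank_of I F < card C"
proof -
  have "C \<noteq> {}" using C m unfolding circuit_def matroid_def by blast
  then obtain c where c: "c \<in> C" by blast
  have CE: "C \<subseteq> E" "C \<notin> I" using C unfolding circuit_def by auto
  have fC: "finite C" using matroid_finite_subset[OF m CE(1)] .
  define X where "X = C - {c}"
  have X: "X \<in> I" unfolding X_def using circuit_minus_indep[OF C c] .
  have cX: "insert c X = C" unfolding X_def using c by blast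
  \<comment> \<open>This is the closure of \<open>X\<close>. The elements of \<open>X\<close> have
    to be added by hand, since inserting them again keeps \<open>X\<close> independent.\<close>
  define F where "F = X \<union> {e \<in> E. insert e X \<notin> I}"
  have CF: "C \<subseteq> F" using CE c cX unfolding F_def X_def by auto
  have FE: "F \<subseteq> E" using CE unfolding F_def X_def by auto
  have rF: "rank_of I F = card X"
  proof (rule rank_of_eqI[OF m X])
    show "X \<subseteq> F" unfolding F_def by blast
    fix W assume W: "W \<in> I" "W \<subseteq> F"
    show "card W \<le> card X"
    proof (rule ccontr)
      assume "\<not> card W \<le> card X"
      then obtain y where "y \<in> W - X" "insert y X \<in> I"
        using indep_augment[OF m X W(1)] by auto
      then show False using W unfolding F_def by blast
    qed
  qed
  have "flat E I F"
    unfolding flat_def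
  proof (intro conjI ballI)
    fix e assume e: "e \<in> E - F"
    then have "insert e X \<in> I" "e \<notin> X" unfolding F_def by auto
    moreover have "insert e X \<subseteq> insert e F" unfolding F_def by blast
    ultimately have "card (insert e X) \<le> rank_of I (insert e F)"
      using card_le_rank_of[OF m] by blast
    then show "rank_of I F < rank_of I (insert e F)"
      using rF \<open>e \<notin> X\<close> indep_finite[OF m X] by simp
  qed (fact FE)
  moreover have "\<exists>D. circuit E I D \<and> e \<in> D \<and> D \<subseteq> F" if e: "e \<in> F" for e
  proof (cases "e \<in> C")
    case True
    then show ?thesis using C CF by blast
  next
    case False
    then have "insert e X \<notin> I" "e \<in> E" using e unfolding F_def X_def by auto
    then obtain D where "circuit E I D" "e \<in> D" "D \<subseteq> insert e X"
      using ex_circuit_insert[OF m X] by blast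
    then show ?thesis using e unfolding F_def by blast
  qed
  ultimately have "cyclic_flat E I F" unfolding cyclic_flat_alt by blast
  moreover have "card X < card C" unfolding X_def using c fC by (meson card_Diff1_less)
  ultimately show ?thesis using CF rF by auto
qed

text \<open>The first inequality holds because \<open>F\<close> is a flat. For the second, some
  \<open>e\<close> in \<open>G - F\<close> lies on a circuit \<open>C\<close> inside
  \<open>G\<close>; a basis of \<open>G\<close> extending \<open>C - {e}\<close> omits
  \<open>e\<close>, so it has fewer than \<open>card (G - F)\<close> elements outside
  \<open>F\<close>.\<close>

lemma cyclic_flat_ranks:
  assumes m: "matroid E I" and F: "cyclic_flat E I F" and G: "cyclic_flat E I G" and FG: "F \<subset> G"
  shows "rank_of I F < rank_of I G" and "rank_of I G + card F < rank_of I F + card G"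
proof -
  obtain e where e: "e \<in> G" "e \<notin> F" using FG by blast
  have GE: "G \<subseteq> E" using G unfolding cyclic_flat_def flat_def by blast
  have fG: "finite G" using matroid_finite_subset[OF m GE] .
  have "rank_of I F < rank_of I (insert e F)"
    using F e GE unfolding cyclic_flat_def flat_def by blast
  also have "\<dots> \<le> rank_of I G" using rank_of_mono[OF m] FG e by blast
  finally show "rank_of I F < rank_of I G" .
  obtain C where C: "circuit E I C" "e \<in> C" "C \<subseteq> G" using G e unfolding cyclic_flat_alt by blast
  have "C - {e} \<subseteq> G" using C(3) by blast
  then obtain Y where Y: "Y \<in> I" "C - {e} \<subseteq> Y" "Y \<subseteq> G" "card Y = rank_of I G"
    using indep_extend[OF m circuit_minus_indep[OF C(1,2)]] by blast
  have "e \<notin> Y"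
  proof
    assume "e \<in> Y"
    then have "C \<subseteq> Y" using Y by blast
    then show False using indep_subset[OF m Y(1)] C unfolding circuit_def by blast
  qed
  have fY: "finite Y" using Y fG finite_subset by blast
  have "card Y = card (Y \<inter> F) + card (Y - F)"
    using fY by (metis card_Int_Diff)
  moreover have "card (Y \<inter> F) \<le> rank_of I F"
    using card_le_rank_of[OF m] indep_subset[OF m Y(1)] by blast
  moreover have "card (Y - F) \<le> card (G - F - {e})"
    using fG Y \<open>e \<notin> Y\<close> by (intro card_mono) auto
  moreover have "card (G - F - {e}) < card (G - F)"
    using e fG by (intro psubset_card_mono) auto
  moreover have "card (G - F) + card F = card G"
    using FG fG by (metis card_Diff_subset card_mono finite_subset le_add_diff_inverse2 psubset_imp_subset)
  ultimately show "rank_of I G + card F < rank_of I F + card G"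
    using Y(4) by linarith
qed

subsection \<open>Chains of flats with prescribed ranks\<close>

text \<open>The bound \<open>r H - r F < |H - F|\<close> is written additively to avoid truncated subtraction.\<close>

definition cprec :: "'a set \<times> nat \<Rightarrow> 'a set \<times> nat \<Rightarrow> bool" where
  "cprec p q \<longleftrightarrow> fst p \<subset> fst q \<and> snd p < snd q \<and> snd q + card (fst p) < snd p + card (fst q)"

text \<open>The chain is a set of pairs, so that equality of chains is equality of sets. Since
  \<open>cprec\<close> requires strict inclusion, comparability also forbids two different ranks on
  the same flat.\<close>

definition cchain :: "'a set \<Rightarrow> ('a set \<times> nat) set \<Rightarrow> bool" where
  "cchain E Z \<longleftrightarrow> fst ` Z \<subseteq> Pow E \<and> ({}, 0) \<in> Z \<and> (\<forall>p\<in>Z. \<forall>q\<in>Z. p = q \<or> cprec p q \<or> cprec q p)"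

definition chain_indep :: "'a set \<Rightarrow> ('a set \<times> nat) set \<Rightarrow> 'a set set" where
  "chain_indep E Z = {X. X \<subseteq> E \<and> (\<forall>(F, a)\<in>Z. card (X \<inter> F) \<le> a)}"

definition flat_ranks :: "'a set \<Rightarrow> 'a set set \<Rightarrow> ('a set \<times> nat) set" where
  "flat_ranks E I = {(F, rank_of I F) | F. cyclic_flat E I F}"

lemma cchain_flat_ranks:
  assumes "nested_matroid E I" "loopfree E I"
  shows "cchain E (flat_ranks E I)"
proof -
  have m: "matroid E I" using assms unfolding nested_matroid_def by blast
  have r0: "rank_of I {} = 0"
    using ex_card_eq_rank_of[OF m, of "{}"] by auto
  \<comment> \<open>Absence of loops is what makes the empty set a flat, which puts the pair
    \<open>({}, 0)\<close> into the chain.\<close>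
  have "flat E I {}"
    unfolding flat_def r0
  proof (intro conjI ballI)
    fix e assume e: "e \<in> E - {}"
    have "{e} \<in> I"
    proof (rule ccontr)
      assume "{e} \<notin> I"
      moreover have "{} \<in> I" using m unfolding matroid_def by blast
      ultimately have "circuit E I {e}" using e unfolding circuit_def
        by (metis Diff_empty empty_subsetI insert_subset psubsetE subset_singletonD)
      then show False using assms(2) e unfolding loopfree_def by blast
    qed
    then show "0 < rank_of I {e}" using card_le_rank_of[OF m, of "{e}" "{e}"] by simp
  qed simp
  then have "cyclic_flat E I {}" unfolding cyclic_flat_alt by blast
  then have "({}, 0) \<in> flat_ranks E I" unfolding flat_ranks_def using r0 by force
  moreover have "fst ` flat_ranks E I \<subseteq> Pow E"
    unfolding flat_ranks_def cyclic_flat_def flat_def by auto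
  moreover have "p = q \<or> cprec p q \<or> cprec q p"
    if "p \<in> flat_ranks E I" "q \<in> flat_ranks E I" for p q
  proof -
    obtain F G where F: "cyclic_flat E I F" "p = (F, rank_of I F)"
      and G: "cyclic_flat E I G" "q = (G, rank_of I G)"
      using \<open>p \<in> _\<close> \<open>q \<in> _\<close> unfolding flat_ranks_def by blast
    have "F = G \<or> F \<subset> G \<or> G \<subset> F"
      using assms(1) F G unfolding nested_matroid_def by blast
    then show ?thesis
      using cyclic_flat_ranks[OF m] F G unfolding cprec_def by auto
  qed
  ultimately show ?thesis unfolding cchain_def by blast
qed

text \<open>The ranks of the cyclic flats determine the matroid: a dependent set contains a circuit
  \<open>C\<close>, and the closure of \<open>C\<close> has rank less than \<open>card C\<close>, so
  its bound is violated.\<close>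

lemma chain_indep_flat_ranks:
  assumes m: "matroid E I"
  shows "chain_indep E (flat_ranks E I) = I"
proof (intro equalityI subsetI)
  fix X assume X: "X \<in> I"
  then have "X \<subseteq> E" using m unfolding matroid_def by blast
  moreover have "card (X \<inter> F) \<le> rank_of I F" for F
    using card_le_rank_of[OF m] indep_subset[OF m X] by blast
  ultimately show "X \<in> chain_indep E (flat_ranks E I)"
    unfolding chain_indep_def flat_ranks_def by auto
next
  fix X assume X: "X \<in> chain_indep E (flat_ranks E I)"
  then have XE: "X \<subseteq> E" unfolding chain_indep_def by blast
  show "X \<in> I"
  proof (rule ccontr)
    assume "X \<notin> I"
    then obtain C where C: "C \<subseteq> X" "circuit E I C" using ex_circuit[OF m XE] by blast
    obtain F where F: "cyclic_flat E I F" "C \<subseteq> F" "rank_of I F < card C"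
      using circuit_closure[OF m C(2)] by blast
    have "card C \<le> card (X \<inter> F)"
      using C F matroid_finite_subset[OF m XE] by (intro card_mono) auto
    moreover have "card (X \<inter> F) \<le> rank_of I F"
      using X F unfolding chain_indep_def flat_ranks_def by blast
    ultimately show False using F by simp
  qed
qed

section \<open>The matroid defined by a chain\<close>

context
  fixes E :: "'a set" and Z :: "('a set \<times> nat) set"
  assumes Z: "cchain E Z"
begin

lemma cchain_subset: "(F, a) \<in> Z \<Longrightarrow> F \<subseteq> E"
proof -
  have "fst ` Z \<subseteq> Pow E" using Z unfolding cchain_def by (rule conjunct1)
  then show "(F, a) \<in> Z \<Longrightarrow> F \<subseteq> E" by force
qed

lemma cchain_empty: "({}, 0) \<in> Z"
  using Z unfolding cchain_def by (elim conjE)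

lemma cchain_comparable: "p \<in> Z \<Longrightarrow> q \<in> Z \<Longrightarrow> p = q \<or> cprec p q \<or> cprec q p"
proof -
  have "\<forall>p\<in>Z. \<forall>q\<in>Z. p = q \<or> cprec p q \<or> cprec q p"
    using Z unfolding cchain_def by (elim conjE)
  then show "p \<in> Z \<Longrightarrow> q \<in> Z \<Longrightarrow> p = q \<or> cprec p q \<or> cprec q p" by blast
qed

lemma cchain_cases:
  assumes "(F, a) \<in> Z" "(G, b) \<in> Z"
  obtains "F = G" "a = b"
  | "F \<subset> G" "a < b" "b + card F < a + card G"
  | "G \<subset> F" "b < a" "a + card G < b + card F"
proof -
  have "(F, a) = (G, b) \<or> cprec (F, a) (G, b) \<or> cprec (G, b) (F, a)"
    using cchain_comparable[OF assms] .
  then show ?thesis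
    by (elim disjE) (use that in \<open>auto simp: cprec_def\<close>)
qed

end

context
  fixes E :: "'a set" and Z :: "('a set \<times> nat) set"
  assumes finE: "finite E" and Z: "cchain E Z"
begin

text \<open>Finiteness of \<open>E\<close> gives a maximal member, and comparability turns it into a
  greatest one.\<close>

lemma cchain_maximal:
  assumes "A \<subseteq> Z" "A \<noteq> {}"
  obtains F a where "(F, a) \<in> A" "\<And>G b. (G, b) \<in> A \<Longrightarrow> G \<subseteq> F"
proof -
  have "fst ` A \<subseteq> Pow E" using assms(1) cchain_subset[OF Z] by fastforce
  then have fin: "finite (fst ` A)" by (metis finE finite_Pow_iff finite_subset)
  have "fst ` A \<noteq> {}" using assms by auto
  then obtain F where F: "F \<in> fst ` A" "\<forall>G\<in>fst ` A. F \<subseteq> G \<longrightarrow> F = G"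
    using finite_has_maximal[OF fin] by blast
  then obtain a where a: "(F, a) \<in> A" by auto
  show ?thesis
  proof (rule that[OF a])
    fix G b assume G: "(G, b) \<in> A"
    have "F \<subseteq> G \<or> G \<subseteq> F"
      by (rule cchain_cases[OF Z subsetD[OF assms(1) a] subsetD[OF assms(1) G]]) auto
    then show "G \<subseteq> F" using F G by force
  qed
qed

text \<open>Take \<open>T\<close> to be the largest tight member, that is, one whose bound is
  attained by \<open>X\<close>; the pair \<open>({}, 0)\<close> is always tight. A member containing
  some \<open>y\<close> outside \<open>T\<close> is not tight, hence has room for
  \<open>y\<close>.\<close>

lemma indep_tight:
  assumes X: "X \<in> chain_indep E Z"
  obtains T c where "(T, c) \<in> Z" "card (X \<inter> T) = c"
    "\<And>y. y \<in> E - T \<Longrightarrow> insert y X \<in> chain_indep E Z"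
proof -
  define A where "A = {(F, a) \<in> Z. card (X \<inter> F) = a}"
  have XE: "X \<subseteq> E" using X unfolding chain_indep_def by blast
  then have fX: "finite X" using finE finite_subset by blast
  have "({}, 0) \<in> A" unfolding A_def using cchain_empty[OF Z] by simp
  then obtain T c where T: "(T, c) \<in> A" "\<And>G b. (G, b) \<in> A \<Longrightarrow> G \<subseteq> T"
    using cchain_maximal[of A] unfolding A_def by blast
  show ?thesis
  proof (rule that)
    show "(T, c) \<in> Z" "card (X \<inter> T) = c" using T unfolding A_def by auto
    fix y assume y: "y \<in> E - T"
    have "card (insert y X \<inter> G) \<le> b" if G: "(G, b) \<in> Z" for G b
    proof (cases "y \<in> G")
      case True
      then have "\<not> G \<subseteq> T" using y by blast
      then have "(G, b) \<notin> A" using T(2) by blast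
      moreover have "card (X \<inter> G) \<le> b" using X G unfolding chain_indep_def by blast
      ultimately have "card (X \<inter> G) < b" unfolding A_def using G by auto
      moreover have "insert y X \<inter> G = insert y (X \<inter> G)" using True by blast
      ultimately show ?thesis using fX by (simp add: card_insert_if)
    next
      case False
      then have "insert y X \<inter> G = X \<inter> G" by blast
      then show ?thesis using X G unfolding chain_indep_def by auto
    qed
    then show "insert y X \<in> chain_indep E Z" using y XE unfolding chain_indep_def by auto
  qed
qed

lemma matroid_chain_indep: "matroid E (chain_indep E Z)"
  unfolding matroid_def
proof (intro conjI ballI allI impI)
  show "{} \<in> chain_indep E Z" unfolding chain_indep_def by auto
  fix X assume X: "X \<in> chain_indep E Z"
  have XE: "X \<subseteq> E" using X(1) unfolding chain_indep_def by blast
  have fX: "finite X" using finite_subset[OF XE finE] .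
  {
    fix Y assume "Y \<subseteq> X"
    then have "card (Y \<inter> F) \<le> card (X \<inter> F)" for F using fX by (intro card_mono) auto
    then show "Y \<in> chain_indep E Z"
      using X \<open>Y \<subseteq> X\<close> unfolding chain_indep_def by (fastforce intro: order_trans)
  next
    fix Y assume Y: "Y \<in> chain_indep E Z" "card X < card Y"
    have YE: "Y \<subseteq> E" using Y unfolding chain_indep_def by blast
    have fY: "finite Y" using finite_subset[OF YE finE] .
    obtain T c where T: "(T, c) \<in> Z" "card (X \<inter> T) = c"
      "\<And>y. y \<in> E - T \<Longrightarrow> insert y X \<in> chain_indep E Z"
      using indep_tight[OF X] by blast
    have "card (Y \<inter> T) \<le> c" using Y T unfolding chain_indep_def by blast
    \<comment> \<open>Inside \<open>T\<close> the set \<open>X\<close> is already as large as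
      possible, so the surplus of \<open>Y\<close> lies outside \<open>T\<close>, where every
      element of \<open>E\<close> may be added to \<open>X\<close>.\<close>
    then have "card (X - T) < card (Y - T)"
      using Y(2) T(2) card_Int_Diff[OF fX, of T] card_Int_Diff[OF fY, of T] by linarith
    then have "\<not> Y - T \<subseteq> X - T" using fX by (meson card_mono finite_Diff leD)
    then obtain y where "y \<in> Y - X" "y \<notin> T" by blast
    then show "\<exists>y\<in>Y - X. insert y X \<in> chain_indep E Z" using T(3) YE by blast
  }
qed (auto simp: finE chain_indep_def)

text \<open>This is where the strict bound on the rank gaps enters. It yields both the rank of
  \<open>F\<close> and, by letting \<open>e\<close> vary over \<open>F\<close>, the circuits that
  cover \<open>F\<close>.\<close>

lemma cchain_basis_avoiding:
  assumes F: "(F, a) \<in> Z"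
  obtains X where "X \<in> chain_indep E Z" "X \<subseteq> F - {e}" "card X = a"
proof -
  let ?I = "chain_indep E Z"
  note m = matroid_chain_indep
  obtain X where X: "X \<in> ?I" "X \<subseteq> F - {e}" "card X = rank_of ?I (F - {e})"
    using ex_card_eq_rank_of[OF m] by blast
  have fF: "finite F" using finE cchain_subset[OF Z F] finite_subset by blast
  have fX: "finite X" using X fF by (meson finite_Diff finite_subset)
  obtain T c where T: "(T, c) \<in> Z" "card (X \<inter> T) = c"
      "\<And>y. y \<in> E - T \<Longrightarrow> insert y X \<in> ?I"
      using indep_tight[OF X(1)] by blast
  have XF: "X \<inter> F = X" using X by blast
  have Xa: "card X \<le> a" using X(1) F XF unfolding chain_indep_def by fastforce
  have "card X = a"
    using F T(1)
  proof (cases rule: cchain_cases[OF Z, consumes 2, case_names 1 2 3])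
    case 1
    then show ?thesis using T(2) XF by simp
  next
    \<comment> \<open>This case is contradictory: a tight \<open>T\<close> above \<open>F\<close>
      would force \<open>card X = b\<close> with \<open>b\<close> the rank of \<open>T\<close>,
      exceeding the bound \<open>a\<close>.\<close>
    case 2
    have "X \<inter> T = X" using 2 X by blast
    then show ?thesis using T(2) 2 Xa by simp
  next
    case 3
    show ?thesis
    proof (rule ccontr)
      \<comment> \<open>Since \<open>a - c < card (F - T)\<close>, a set \<open>X\<close> that is
        too small misses at least two elements of \<open>F - T\<close>. One of them differs from
        \<open>e\<close> and can be added, against the maximality of \<open>X\<close>.\<close>
      assume "card X \<noteq> a"
      then have "card X < a" using Xa by simp
      then have "card (X - T) < a - c" using card_Int_Diff[OF fX, of T] T(2) by linarith
      moreover have "card (F - T) = card F - card T"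
        using 3 fF by (meson card_Diff_subset finite_subset psubset_imp_subset)
      ultimately have "card (X - T) + 1 < card (F - T)" using 3 by linarith
      moreover have "card (F - T) \<le> card (F - T - {e}) + 1"
        by (metis Suc_eq_plus1 card_Diff1_le card_Diff_singleton_if diff_Suc_1 le_SucI le_diff_conv nat_le_linear)
      ultimately have "card (X - T) < card (F - T - {e})" by linarith
      then have "\<not> F - T - {e} \<subseteq> X - T" using fX by (meson card_mono finite_Diff leD)
      then obtain y where y: "y \<in> F - T" "y \<noteq> e" "y \<notin> X" by blast
      then have "insert y X \<in> ?I" using T(3) cchain_subset[OF Z F] by blast
      moreover have "insert y X \<subseteq> F - {e}" using y X by blast
      ultimately have "card (insert y X) \<le> card X"
        using card_le_rank_of[OF m] X(3) by metis
      then show False using y fX by simp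
    qed
  qed
  then show ?thesis using X that by blast
qed

lemma rank_of_chain_indep:
  assumes F: "(F, a) \<in> Z"
  shows "rank_of (chain_indep E Z) F = a"
proof -
  \<comment> \<open>Any element may be avoided here; \<open>undefined\<close> is an arbitrary
    choice.\<close>
  obtain X where X: "X \<in> chain_indep E Z" "X \<subseteq> F - {undefined}" "card X = a"
    using cchain_basis_avoiding[OF F] by blast
  have "card W \<le> card X" if "W \<in> chain_indep E Z" "W \<subseteq> F" for W
  proof -
    have "W \<inter> F = W" using that by blast
    then show ?thesis using that F X unfolding chain_indep_def by fastforce
  qed
  then show ?thesis using rank_of_eqI[OF matroid_chain_indep X(1), of F] X by blast
qed

text \<open>A member of the chain that contains \<open>e\<close> lies strictly above
  \<open>F\<close>, so its rank exceeds \<open>a\<close> and leaves room for one more element. This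
  gives flatness of \<open>F\<close>, and loopfreeness for \<open>F = {}\<close>.\<close>

lemma insert_basis_chain_indep:
  assumes F: "(F, a) \<in> Z" and X: "X \<in> chain_indep E Z" "X \<subseteq> F" "card X = a" and e: "e \<in> E - F"
  shows "insert e X \<in> chain_indep E Z"
proof -
  have XE: "X \<subseteq> E" using X(1) unfolding chain_indep_def by blast
  have fX: "finite X" using finite_subset[OF XE finE] .
  have "card (insert e X \<inter> G) \<le> b" if G: "(G, b) \<in> Z" for G b
  proof (cases "e \<in> G")
    case True
    have "a < b" by (rule cchain_cases[OF Z F G]) (use True e in auto)
    moreover have "card (insert e X \<inter> G) \<le> card (insert e X)"
      using fX by (intro card_mono) auto
    moreover have "card (insert e X) \<le> Suc a" using X(3) fX by (simp add: card_insert_if)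
    ultimately show ?thesis by linarith
  next
    case False
    then have "insert e X \<inter> G = X \<inter> G" by blast
    then show ?thesis using X G unfolding chain_indep_def by auto
  qed
  then show ?thesis using e XE unfolding chain_indep_def by auto
qed

text \<open>Adding \<open>e\<close> to a basis of \<open>F\<close> that avoids \<open>e\<close>
  keeps it independent when \<open>e\<close> is outside \<open>F\<close>. When \<open>e\<close> is
  in \<open>F\<close> it exceeds the bound \<open>a\<close>, which produces a circuit through
  \<open>e\<close> inside \<open>F\<close>.\<close>

lemma cyclic_flat_chain_indep:
  assumes F: "(F, a) \<in> Z"
  shows "cyclic_flat E (chain_indep E Z) F"
proof -
  let ?I = "chain_indep E Z"
  note m = matroid_chain_indep
  note FE = cchain_subset[OF Z F]
  have "flat E ?I F"
    unfolding flat_def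
  proof (intro conjI ballI)
    fix e assume e: "e \<in> E - F"
    obtain X where X: "X \<in> ?I" "X \<subseteq> F - {e}" "card X = a"
      using cchain_basis_avoiding[OF F] by blast
    have "insert e X \<in> ?I" using insert_basis_chain_indep[OF F X(1) _ X(3) e] X by blast
    then have "card (insert e X) \<le> rank_of ?I (insert e F)"
      using card_le_rank_of[OF m] X by blast
    moreover have "e \<notin> X" using X by blast
    ultimately show "rank_of ?I F < rank_of ?I (insert e F)"
      using rank_of_chain_indep[OF F] X(3) indep_finite[OF m X(1)] by simp
  qed (fact FE)
  moreover have "\<exists>C. circuit E ?I C \<and> e \<in> C \<and> C \<subseteq> F" if e: "e \<in> F" for e
  proof -
    obtain X where X: "X \<in> ?I" "X \<subseteq> F - {e}" "card X = a"
      using cchain_basis_avoiding[OF F] by blast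
    have "insert e X \<inter> F = insert e X" "e \<notin> X" using e X by auto
    then have "card (insert e X \<inter> F) = Suc a" using X(3) indep_finite[OF m X(1)] by simp
    then have "insert e X \<notin> ?I" using F unfolding chain_indep_def by fastforce
    then show ?thesis using ex_circuit_insert[OF m X(1)] e X FE by blast
  qed
  ultimately show ?thesis unfolding cyclic_flat_alt by blast
qed

text \<open>Every element of \<open>H\<close> turns out to lie in some member of the chain contained
  in \<open>H\<close>; the largest member contained in \<open>H\<close> must then be
  \<open>H\<close> itself.\<close>

lemma cyclic_flat_chain_indepD:
  assumes H: "cyclic_flat E (chain_indep E Z) H"
  shows "\<exists>a. (H, a) \<in> Z"
proof -
  let ?I = "chain_indep E Z"
  note m = matroid_chain_indep
  have fl: "flat E ?I H" and HE: "H \<subseteq> E" using H unfolding cyclic_flat_def flat_def by auto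
  have T: "\<exists>T c. (T, c) \<in> Z \<and> e \<in> T \<and> T \<subseteq> H" if e: "e \<in> H" for e
  proof -
    obtain C where C: "circuit E ?I C" "e \<in> C" "C \<subseteq> H"
      using H e unfolding cyclic_flat_alt by blast
    have "C - {e} \<subseteq> H" using C(3) by blast
    then obtain X where X: "X \<in> ?I" "C - {e} \<subseteq> X" "X \<subseteq> H" "card X = rank_of ?I H"
      \<comment> \<open>\<open>X\<close> is a basis of \<open>H\<close> to which \<open>e\<close>
        cannot be added. The largest member that is tight for \<open>X\<close> therefore contains
        \<open>e\<close>.\<close>
      using indep_extend[OF m circuit_minus_indep[OF C(1,2)]] by blast
    have eX: "insert e X \<notin> ?I"
    proof
      assume "insert e X \<in> ?I"
      moreover have "C \<subseteq> insert e X" using X by blast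
      ultimately show False using indep_subset[OF m] C unfolding circuit_def by blast
    qed
    obtain T c where T: "(T, c) \<in> Z" "card (X \<inter> T) = c"
      "\<And>y. y \<in> E - T \<Longrightarrow> insert y X \<in> ?I"
      using indep_tight[OF X(1)] by blast
    have "e \<in> T" using T(3) eX e HE by blast
    moreover have "T \<subseteq> H"
    proof
      fix y assume y: "y \<in> T"
      show "y \<in> H"
      proof (rule ccontr)
        assume yH: "y \<notin> H"
        \<comment> \<open>Flatness of \<open>H\<close> allows \<open>X\<close> to be augmented
          within \<open>insert y H\<close>. Augmenting by \<open>y\<close> would overfill the tight
          member \<open>T\<close>, and any other element would enlarge a basis of
          \<open>H\<close>.\<close>
        then have "rank_of ?I H < rank_of ?I (insert y H)"
          using fl y cchain_subset[OF Z T(1)] unfolding flat_def by blast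
        then obtain Y where Y: "Y \<in> ?I" "Y \<subseteq> insert y H" "card X < card Y"
          using ex_card_eq_rank_of[OF m] X(4) by metis
        then obtain z where z: "z \<in> Y - X" "insert z X \<in> ?I"
          using indep_augment[OF m X(1)] by blast
        show False
        proof (cases "z = y")
          case True
          have "insert y X \<inter> T = insert y (X \<inter> T)" "y \<notin> X" using y yH X by auto
          then have "card (insert y X \<inter> T) = Suc c"
            using T(2) indep_finite[OF m X(1)] by simp
          then show False using z True T(1) unfolding chain_indep_def by fastforce
        next
          case False
          then have "insert z X \<subseteq> H" using z Y X by blast
          then have "card (insert z X) \<le> card X"
            using card_le_rank_of[OF m z(2)] X(4) by simp
          then show False using z indep_finite[OF m X(1)] by simp
        qed
      qed
    qed
    ultimately show ?thesis using T by blast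
  qed
  define A where "A = {(F, a) \<in> Z. F \<subseteq> H}"
  have "({}, 0) \<in> A" unfolding A_def using cchain_empty[OF Z] by simp
  then obtain F a where F: "(F, a) \<in> A" "\<And>G b. (G, b) \<in> A \<Longrightarrow> G \<subseteq> F"
    using cchain_maximal[of A] unfolding A_def by blast
  have "H \<subseteq> F"
  proof
    fix e assume "e \<in> H"
    then obtain T c where "(T, c) \<in> Z" "e \<in> T" "T \<subseteq> H" using T by blast
    then show "e \<in> F" using F(2)[of T c] unfolding A_def by blast
  qed
  then have "F = H" using F(1) unfolding A_def by blast
  then show ?thesis using F(1) unfolding A_def by blast
qed

lemma flat_ranks_chain_indep: "flat_ranks E (chain_indep E Z) = Z"
proof (intro equalityI subrelI)
  fix F a assume "(F, a) \<in> flat_ranks E (chain_indep E Z)"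
  then have F: "cyclic_flat E (chain_indep E Z) F" "a = rank_of (chain_indep E Z) F"
    unfolding flat_ranks_def by auto
  then obtain b where b: "(F, b) \<in> Z" using cyclic_flat_chain_indepD[OF F(1)] by blast
  then show "(F, a) \<in> Z" using rank_of_chain_indep[OF b] F(2) by simp
next
  fix F a assume F: "(F, a) \<in> Z"
  show "(F, a) \<in> flat_ranks E (chain_indep E Z)"
    unfolding flat_ranks_def using cyclic_flat_chain_indep[OF F] rank_of_chain_indep[OF F] by blast
qed

lemma nested_chain_indep: "nested_matroid E (chain_indep E Z)"
  unfolding nested_matroid_def
proof (intro conjI allI impI)
  fix F G assume "cyclic_flat E (chain_indep E Z) F" "cyclic_flat E (chain_indep E Z) G"
  then obtain a b where F: "(F, a) \<in> Z" and G: "(G, b) \<in> Z"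
    by (meson cyclic_flat_chain_indepD)
  show "F \<subseteq> G \<or> G \<subseteq> F" by (rule cchain_cases[OF Z F G]) auto
qed (fact matroid_chain_indep)

lemma loopfree_chain_indep: "loopfree E (chain_indep E Z)"
  unfolding loopfree_def
proof
  fix e assume e: "e \<in> E"
  have "insert e {} \<in> chain_indep E Z"
    by (rule insert_basis_chain_indep[OF cchain_empty[OF Z]]) (auto simp: e chain_indep_def)
  then show "\<not> circuit E (chain_indep E Z) {e}" unfolding circuit_def by blast
qed

text \<open>Elements outside the largest cyclic flat are coloops: a basis of \<open>F\<close>
  together with all of \<open>E - F\<close> is a basis of the matroid.\<close>

lemma rank_of_chain_indep_top:
  assumes F: "(F, a) \<in> Z" and top: "\<And>G b. (G, b) \<in> Z \<Longrightarrow> G \<subseteq> F"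
  shows "rank_of (chain_indep E Z) E = a + card (E - F)"
proof -
  let ?I = "chain_indep E Z"
  note m = matroid_chain_indep
  obtain X where X: "X \<in> ?I" "X \<subseteq> F - {undefined}" "card X = a"
    using cchain_basis_avoiding[OF F] by blast
  have XF: "X \<subseteq> F" using X by blast
  have FE: "F \<subseteq> E" using cchain_subset[OF Z F] .
  define B where "B = X \<union> (E - F)"
  have B: "B \<in> ?I"
  proof -
    have "B \<inter> G = X \<inter> G" if "(G, b) \<in> Z" for G b using top[OF that] unfolding B_def by blast
    then show ?thesis using X FE XF unfolding chain_indep_def B_def by fastforce
  qed
  have cB: "card B = a + card (E - F)"
    unfolding B_def using X(3) XF finE indep_finite[OF m X(1)]
    by (subst card_Un_disjoint) auto
  have le: "card W \<le> card B" if W: "W \<in> ?I" "W \<subseteq> E" for W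
  proof -
    have "card W = card (W \<inter> F) + card (W - F)"
      using card_Int_Diff indep_finite[OF m W(1)] by blast
    moreover have "card (W \<inter> F) \<le> a" using W F unfolding chain_indep_def by blast
    moreover have "card (W - F) \<le> card (E - F)" using W finE by (intro card_mono) auto
    ultimately show ?thesis using cB by linarith
  qed
  have "B \<subseteq> E" using XF FE unfolding B_def by blast
  then show ?thesis using rank_of_eqI[OF m B _ le] cB by simp
qed

end

subsection \<open>Exponential generating functions of set functions\<close>

lemma sum_Pow_card:
  fixes h :: "nat \<Rightarrow> 'b::comm_semiring_1"
  assumes "finite E"
  shows "(\<Sum>F\<in>Pow E. h (card F)) = (\<Sum>k\<le>card E. of_nat (card E choose k) * h k)"
proof -
  have "(\<Sum>F\<in>Pow E. h (card F)) = (\<Sum>k\<le>card E. \<Sum>F | F \<in> Pow E \<and> card F = k. h (card F))"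
    by (rule sum.group[symmetric]) (use assms in \<open>auto intro: card_mono\<close>)
  also have "\<dots> = (\<Sum>k\<le>card E. of_nat (card {F. F \<subseteq> E \<and> card F = k}) * h k)"
    by (intro sum.cong) auto
  finally show ?thesis using n_subsets[OF assms] by simp
qed

text \<open>Convolution over subsets corresponds to the product of exponential generating functions;
  the factorials undo the normalisation of the coefficients.\<close>

lemma sum_Pow_fps_mult:
  fixes A B :: "real fps"
  assumes "finite E"
  shows "(\<Sum>F\<in>Pow E. (fact (card F) * A $ card F) * (fact (card (E - F)) * B $ card (E - F)))
    = fact (card E) * (A * B) $ card E"
proof -
  let ?n = "card E"
  have "(\<Sum>F\<in>Pow E. (fact (card F) * A $ card F) * (fact (card (E - F)) * B $ card (E - F)))
    = (\<Sum>F\<in>Pow E. (fact (card F) * A $ card F) * (fact (?n - card F) * B $ (?n - card F)))"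
    using assms by (intro sum.cong) (auto simp: card_Diff_subset finite_subset)
  also have "\<dots> = (\<Sum>k\<le>?n. of_nat (?n choose k) * ((fact k * A $ k) * (fact (?n - k) * B $ (?n - k))))"
    by (rule sum_Pow_card[OF assms])
  also have "\<dots> = (\<Sum>k\<le>?n. fact ?n * (A $ k * B $ (?n - k)))"
    by (intro sum.cong) (auto simp: binomial_fact field_simps)
  also have "\<dots> = fact ?n * (A * B) $ ?n"
    by (simp add: fps_mult_nth sum_distrib_left atMost_atLeast0)
  finally show ?thesis .
qed

text \<open>With \<open>H\<close> the exponential generating function of \<open>h\<close>, the
  recursion reads \<open>H = 1 + H * K\<close>. The induction also shows that \<open>h\<close>
  depends only on the cardinality. It serves for chains and for permutations alike.\<close>

lemma set_renewal_fps:
  fixes h :: "'a set \<Rightarrow> real" and k :: "nat \<Rightarrow> real"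
  assumes empty: "h {} = 1"
    and rec: "\<And>E. finite E \<Longrightarrow> E \<noteq> {} \<Longrightarrow> h E = (\<Sum>F | F \<subset> E. h F * k (card (E - F)))"
    and fin: "finite E"
    and K: "K = Abs_fps (\<lambda>n. if n = 0 then 0 else k n / fact n)"
  shows "h E = fact (card E) * inverse (1 - K) $ card E"
  using fin
proof (induction E rule: finite_psubset_induct)
  case (psubset E)
  let ?Q = "inverse (1 - K)"
  have Q: "?Q * (1 - K) = 1" by (rule inverse_mult_eq_1) (simp add: K)
  then have Q': "?Q = 1 + ?Q * K" by (simp add: algebra_simps)
  show ?case
  proof (cases "E = {}")
    case True
    then show ?thesis using empty by (simp add: K)
  next
    case False
    \<comment> \<open>The vanishing constant term of \<open>K\<close> kills the summand
      \<open>F = E\<close>, so the sum over proper subsets is a full convolution.\<close>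
    have "Pow E = insert E {F. F \<subset> E}" "finite {F. F \<subset> E}" "K $ 0 = 0"
      using psubset.hyps by (auto simp: K intro: finite_subset[of _ "Pow E"])
    then have *: "(\<Sum>F\<in>Pow E. (fact (card F) * ?Q $ card F) * (fact (card (E - F)) * K $ card (E - F)))
      = (\<Sum>F | F \<subset> E. (fact (card F) * ?Q $ card F) * (fact (card (E - F)) * K $ card (E - F)))"
      by simp
    have "h E = (\<Sum>F | F \<subset> E. h F * k (card (E - F)))" using rec psubset.hyps False by blast
    also have "\<dots> = (\<Sum>F | F \<subset> E. (fact (card F) * ?Q $ card F) * (fact (card (E - F)) * K $ card (E - F)))"
    proof (intro sum.cong refl)
      fix F assume "F \<in> {F. F \<subset> E}"
      then have "F \<subset> E" by simp
      then have "E - F \<noteq> {}" by blast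
      then have "card (E - F) \<noteq> 0" using psubset.hyps by simp
      then have "fact (card (E - F)) * K $ card (E - F) = k (card (E - F))" by (simp add: K)
      then show "h F * k (card (E - F))
        = (fact (card F) * ?Q $ card F) * (fact (card (E - F)) * K $ card (E - F))"
        using psubset.IH[OF \<open>F \<subset> E\<close>] by simp
    qed
    also have "\<dots> = fact (card E) * (?Q * K) $ card E"
      unfolding *[symmetric] by (rule sum_Pow_fps_mult[OF psubset.hyps])
    also have "(?Q * K) $ card E = ?Q $ card E"
      using arg_cong[OF Q', of "\<lambda>f. f $ card E"] False psubset.hyps by simp
    finally show ?thesis .
  qed
qed

section \<open>The generating function identity and comparison of coefficients\<close>

lemma geometric_aux:
  fixes t :: real
  shows "n \<noteq> 0 \<Longrightarrow> (t - 1) * (\<Sum>d = 1..<n. t ^ d) = t ^ n - t"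
proof (induction n)
  case (Suc n)
  then show ?case by (cases "n = 0") (auto simp: algebra_simps)
qed simp

text \<open>Multiplication by \<open>t - 1\<close> sums the geometric progressions in
  \<open>G\<close> and completes the powers in \<open>K\<close>, turning \<open>1 - G\<close> and
  \<open>1 - K\<close> into combinations of exponentials.\<close>

lemma nested_eulerian_fps:
  fixes t :: real
  assumes t: "t \<noteq> 1"
    and G: "G = Abs_fps (\<lambda>n. if n = 0 then 0 else (\<Sum>d = 1..<n. t ^ d) / fact n)"
    and K: "K = Abs_fps (\<lambda>n. if n = 0 then 0 else (t - 1) ^ (n - 1) / fact n)"
  shows "inverse (1 - G) * fps_exp t = 1 - fps_const t + fps_const t * inverse (1 - K)"
proof -
  define c where "c = fps_const t - (1 :: real fps)"
  define T where "T = fps_const t"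
  have "c $ 0 \<noteq> 0" unfolding c_def using t by simp
  then have c0: "c \<noteq> 0" by auto
  have cG: "c * (1 - G) = T * fps_exp 1 - fps_exp t"
  proof (rule fps_ext)
    fix n
    have "c = fps_const (t - 1)" unfolding c_def by (rule fps_ext) simp
    then have "(c * (1 - G)) $ n = (t - 1) * (1 - G) $ n" by simp
    also have "\<dots> = (T * fps_exp 1 - fps_exp t) $ n"
    proof (cases "n = 0")
      case False
      have "(t - 1) * (1 - G) $ n = - ((t - 1) * (\<Sum>d = 1..<n. t ^ d)) / fact n"
        using False by (simp add: G)
      then show ?thesis
        using False geometric_aux[OF False, of t] by (simp add: T_def field_simps)
    qed (simp add: G T_def)
    finally show "(c * (1 - G)) $ n = (T * fps_exp 1 - fps_exp t) $ n" .
  qed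
  have cK: "c * (1 - K) = T - fps_exp (t - 1)"
  proof (rule fps_ext)
    fix n
    have "c = fps_const (t - 1)" unfolding c_def by (rule fps_ext) simp
    then have "(c * (1 - K)) $ n = (t - 1) * (1 - K) $ n" by simp
    also have "\<dots> = (T - fps_exp (t - 1)) $ n"
      by (cases n) (simp_all add: K T_def del: fact_Suc)
    finally show "(c * (1 - K)) $ n = (T - fps_exp (t - 1)) $ n" .
  qed
  have e: "fps_exp 1 * fps_exp (t - 1) = fps_exp t"
    using fps_exp_add_mult[of 1 "t - 1"] by simp
  have a: "inverse (1 - G) * (1 - G) = 1" by (rule inverse_mult_eq_1) (simp add: G)
  have b: "inverse (1 - K) * (1 - K) = 1" by (rule inverse_mult_eq_1) (simp add: K)
  have a0: "1 - G \<noteq> 0" and b0: "1 - K \<noteq> 0" using a b by fastforce+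
  \<comment> \<open>\<open>?X\<close> is the difference of the two sides. It vanishes because its
    product with the nonzero series \<open>c * c\<close>, \<open>1 - G\<close> and
    \<open>1 - K\<close> reduces to the addition law of \<open>fps_exp\<close>.\<close>
  let ?X = "inverse (1 - G) * fps_exp t - (1 - T + T * inverse (1 - K))"
  have "?X * (1 - G) * (1 - K) = fps_exp t * (1 - K) - (1 - G) * ((1 - T) * (1 - K) + T)"
    using a b by algebra
  then have "c * c * (?X * (1 - G) * (1 - K))
    = c * c * (fps_exp t * (1 - K) - (1 - G) * ((1 - T) * (1 - K) + T))"
    by (simp only:)
  also have "\<dots> = c * fps_exp t * (c * (1 - K)) - (c * (1 - G)) * ((1 - T) * (c * (1 - K)) + T * c)"
    by algebra
  also have "\<dots> = c * T * (fps_exp t - fps_exp 1 * fps_exp (t - 1))"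
    unfolding cG cK unfolding c_def T_def[symmetric] by algebra
  also have "\<dots> = 0" using e by simp
  finally have "?X = 0" using c0 a0 b0 by simp
  then show ?thesis unfolding T_def by simp
qed

text \<open>The level sizes are coefficients of polynomials in \<open>t\<close>, which are
  determined by their values at infinitely many points. The point 1 is left out because the identity
  of power series is obtained after multiplying by \<open>t - 1\<close>.\<close>

lemma card_level_eqI:
  fixes f :: "'a \<Rightarrow> nat" and g :: "'b \<Rightarrow> nat"
  assumes fin: "finite A" "finite B"
    and eq: "\<And>t :: real. t \<noteq> 1 \<Longrightarrow> (\<Sum>x\<in>A. t ^ f x) = (\<Sum>x\<in>B. t ^ g x)"
  shows "card {x \<in> A. f x = k} = card {x \<in> B. g x = k}"
proof -
  \<comment> \<open>\<open>k\<close> is included so that its coefficient is among those compared,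
    even if neither function attains it.\<close>
  obtain m where m: "f ` A \<union> g ` B \<union> {k} \<subseteq> {..m}"
    using fin finite_nat_set_iff_bounded_le[of "f ` A \<union> g ` B \<union> {k}"] by auto
  have A: "(\<Sum>x\<in>A. t ^ f x) = (\<Sum>i\<le>m. real (card {x \<in> A. f x = i}) * t ^ i)" for t :: real
  proof -
    have "(\<Sum>x\<in>A. t ^ f x) = (\<Sum>i\<le>m. \<Sum>x | x \<in> A \<and> f x = i. t ^ f x)"
      by (rule sum.group[symmetric]) (use fin m in auto)
    also have "\<dots> = (\<Sum>i\<le>m. real (card {x \<in> A. f x = i}) * t ^ i)" by (intro sum.cong) auto
    finally show ?thesis .
  qed
  have B: "(\<Sum>x\<in>B. t ^ g x) = (\<Sum>i\<le>m. real (card {x \<in> B. g x = i}) * t ^ i)" for t :: real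
  proof -
    have "(\<Sum>x\<in>B. t ^ g x) = (\<Sum>i\<le>m. \<Sum>x | x \<in> B \<and> g x = i. t ^ g x)"
      by (rule sum.group[symmetric]) (use fin m in auto)
    also have "\<dots> = (\<Sum>i\<le>m. real (card {x \<in> B. g x = i}) * t ^ i)" by (intro sum.cong) auto
    finally show ?thesis .
  qed
  define c where "c i = real (card {x \<in> A. f x = i}) - real (card {x \<in> B. g x = i})" for i
  have "- {1} \<subseteq> {t :: real. (\<Sum>i\<le>m. c i * t ^ i) = 0}"
    using eq unfolding A B c_def by (auto simp: left_diff_distrib sum_subtractf)
  moreover have "infinite (- {1 :: real})" by (simp add: infinite_UNIV_char_0)
  ultimately have "infinite {t :: real. (\<Sum>i\<le>m. c i * t ^ i) = 0}" using finite_subset by blast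
  then have "\<forall>i\<le>m. c i = 0" using polyfun_finite_roots by blast
  then have "c k = 0" using m by auto
  then show ?thesis unfolding c_def by simp
qed

subsection \<open>Ascents\<close>

fun asc :: "'a::linorder list \<Rightarrow> nat" where
  "asc (x # y # ys) = (if x < y then 1 else 0) + asc (y # ys)"
| "asc _ = 0"

text \<open>The list runs up to \<open>b\<close> inclusive, since an ascent at \<open>b - 1\<close>
  compares with the value at \<open>b\<close>. The left end \<open>a\<close> is free for the
  induction.\<close>

lemma card_ascents_eq_asc:
  "card {i \<in> {a..<b}. \<sigma> i < \<sigma> (i + 1)} = asc (map \<sigma> [a..<Suc b])" for \<sigma> :: "nat \<Rightarrow> nat"
proof (induction "b - a" arbitrary: a)
  case 0
  then show ?case by (cases "a = b") (auto simp: upt_rec)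
next
  case (Suc k)
  then have ab: "a < b" by simp
  have "{i \<in> {a..<b}. \<sigma> i < \<sigma> (i + 1)}
    = (if \<sigma> a < \<sigma> (Suc a) then {a} else {}) \<union> {i \<in> {Suc a..<b}. \<sigma> i < \<sigma> (i + 1)}"
    using ab by (auto simp: Suc_le_eq order_le_less)
  moreover have "card ((if \<sigma> a < \<sigma> (Suc a) then {a} else {}) \<union> {i \<in> {Suc a..<b}. \<sigma> i < \<sigma> (i + 1)})
    = (if \<sigma> a < \<sigma> (Suc a) then 1 else 0) + card {i \<in> {Suc a..<b}. \<sigma> i < \<sigma> (i + 1)}"
    by simp
  ultimately have "card {i \<in> {a..<b}. \<sigma> i < \<sigma> (i + 1)}
    = (if \<sigma> a < \<sigma> (Suc a) then 1 else 0) + card {i \<in> {Suc a..<b}. \<sigma> i < \<sigma> (i + 1)}"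
    by (simp only:)
  also have "\<dots> = (if \<sigma> a < \<sigma> (Suc a) then 1 else 0) + asc (map \<sigma> [Suc a..<Suc b])"
    using Suc by simp
  also have "\<dots> = asc (map \<sigma> [a..<Suc b])"
  proof -
    have "[a..<Suc b] = a # Suc a # [Suc (Suc a)..<Suc b]"
      using ab upt_conv_Cons[of a "Suc b"] upt_conv_Cons[of "Suc a" "Suc b"] by (simp only: less_SucI Suc_mono)
    moreover have "[Suc a..<Suc b] = Suc a # [Suc (Suc a)..<Suc b]"
      using ab by (intro upt_conv_Cons) simp
    ultimately show ?thesis by (simp only: list.map asc.simps)
  qed
  finally show ?case .
qed

text \<open>This is one-line notation relative to \<open>xs\<close>. Surjectivity follows from
  injectivity by counting.\<close>

lemma bij_betw_permutes_permutations_of_set: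
  assumes xs: "distinct xs"
  shows "bij_betw (\<lambda>\<sigma>. map \<sigma> xs) {\<sigma>. \<sigma> permutes set xs} (permutations_of_set (set xs))"
proof (rule bij_betw_imageI)
  show inj: "inj_on (\<lambda>\<sigma>. map \<sigma> xs) {\<sigma>. \<sigma> permutes set xs}"
  proof (rule inj_onI)
    fix \<sigma> \<tau> assume p: "\<sigma> \<in> {\<sigma>. \<sigma> permutes set xs}" "\<tau> \<in> {\<sigma>. \<sigma> permutes set xs}"
      and eq: "map \<sigma> xs = map \<tau> xs"
    show "\<sigma> = \<tau>"
    proof
      fix x show "\<sigma> x = \<tau> x"
        using p eq by (cases "x \<in> set xs") (auto simp: permutes_not_in)
    qed
  qed
  show "(\<lambda>\<sigma>. map \<sigma> xs) ` {\<sigma>. \<sigma> permutes set xs} = permutations_of_set (set xs)"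
  proof (rule card_subset_eq)
    show "(\<lambda>\<sigma>. map \<sigma> xs) ` {\<sigma>. \<sigma> permutes set xs} \<subseteq> permutations_of_set (set xs)"
      using xs by (auto simp: permutations_of_set_def distinct_map permutes_image permutes_inj_on
          simp del: set_map simp flip: image_set)
    show "card ((\<lambda>\<sigma>. map \<sigma> xs) ` {\<sigma>. \<sigma> permutes set xs}) = card (permutations_of_set (set xs))"
      by (simp add: card_image[OF inj] card_permutations)
  qed simp
qed

lemma eulerian_eq_card_asc: "eulerian r n = card {xs \<in> permutations_of_set {1..n}. asc xs = r}"
proof -
  have set: "set [1..<Suc n] = {1..n}" by auto
  have b: "bij_betw (\<lambda>\<sigma>. map \<sigma> [1..<Suc n]) {\<sigma>. \<sigma> permutes {1..n}} (permutations_of_set {1..n})"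
    using bij_betw_permutes_permutations_of_set[of "[1..<Suc n]"] unfolding set by simp
  have "bij_betw (\<lambda>\<sigma>. map \<sigma> [1..<Suc n]) {\<sigma> \<in> {\<sigma>. \<sigma> permutes {1..n}}. card (ascents n \<sigma>) = r}
    {xs \<in> permutations_of_set {1..n}. asc xs = r}"
    by (rule bij_betw_Collect[OF b]) (simp only: ascents_def card_ascents_eq_asc)
  then show ?thesis unfolding eulerian_def using bij_betw_same_card by fastforce
qed

text \<open>Each initial ascent contributes \<open>t = 1 + (t - 1)\<close>: the 1 cuts the list
  after its head, and \<open>t - 1\<close> extends the increasing prefix. The index \<open>j\<close>
  counts the ascents of a prefix of length \<open>Suc j\<close>.\<close>

lemma power_asc_eq_sum_increasing_prefixes:
  fixes t :: "'b::comm_ring_1" and xs :: "'a::linorder list"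
  assumes "xs \<noteq> []" "distinct xs"
  shows "t ^ asc xs = (\<Sum>j | j < length xs \<and> sorted (take (Suc j) xs). (t - 1) ^ j * t ^ asc (drop (Suc j) xs))"
  using assms
proof (induction xs rule: asc.induct)
  case (1 x y ys)
  let ?J = "\<lambda>zs :: 'a list. {j. j < length zs \<and> sorted (take (Suc j) zs)}"
  have "?J (x # y # ys) = (if x < y then insert 0 (Suc ` ?J (y # ys)) else {0})"
  proof (cases "x < y")
    case True
    have "sorted (take (Suc j) (x # y # ys)) \<longleftrightarrow> sorted (take j (y # ys))" for j
      using True by (cases j) (auto simp: sorted_wrt.simps dest: order.trans[of x y])
    then have "j \<in> ?J (x # y # ys) \<longleftrightarrow> j \<in> insert 0 (Suc ` ?J (y # ys))" for j
      by (cases j) auto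
    then show ?thesis using True by auto
  next
    case False
    then have "y < x" using 1(3) by auto
    then have "j \<in> ?J (x # y # ys) \<longleftrightarrow> j = 0" for j by (cases j) auto
    then show ?thesis using False by auto
  qed
  then have "(\<Sum>j\<in>?J (x # y # ys). (t - 1) ^ j * t ^ asc (drop (Suc j) (x # y # ys)))
    = t ^ asc (y # ys) + (if x < y then
        (\<Sum>j\<in>Suc ` ?J (y # ys). (t - 1) ^ j * t ^ asc (drop (Suc j) (x # y # ys))) else 0)"
    by simp
  also have "(\<Sum>j\<in>Suc ` ?J (y # ys). (t - 1) ^ j * t ^ asc (drop (Suc j) (x # y # ys)))
    = (t - 1) * (\<Sum>j\<in>?J (y # ys). (t - 1) ^ j * t ^ asc (drop (Suc j) (y # ys)))"
    by (subst sum.reindex) (simp_all add: sum_distrib_left mult.assoc)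
  also have "(\<Sum>j\<in>?J (y # ys). (t - 1) ^ j * t ^ asc (drop (Suc j) (y # ys))) = t ^ asc (y # ys)"
    using 1 by simp
  also have "t ^ asc (y # ys) + (if x < y then (t - 1) * t ^ asc (y # ys) else 0) = t ^ asc (x # y # ys)"
    by (simp add: left_diff_distrib)
  finally show ?case ..
next
  case ("2_2" x)
  have "{j. j < length [x] \<and> sorted (take (Suc j) [x])} = {0}" by auto
  then show ?case by (simp only:) simp
qed simp

text \<open>Splitting off an increasing prefix of a permutation is choosing its set of entries.\<close>

lemma sum_power_asc_rec:
  fixes t :: real and S :: "'a::linorder set"
  assumes fin: "finite S" and ne: "S \<noteq> {}"
  shows "(\<Sum>xs\<in>permutations_of_set S. t ^ asc xs)
    = (\<Sum>F | F \<subset> S. (\<Sum>xs\<in>permutations_of_set F. t ^ asc xs) * (t - 1) ^ (card (S - F) - 1))"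
proof -
  define L where "L = (SIGMA xs : permutations_of_set S. {j. j < length xs \<and> sorted (take (Suc j) xs)})"
  define R where "R = (SIGMA F : {F. F \<subset> S}. permutations_of_set F)"
  have "(\<Sum>xs\<in>permutations_of_set S. t ^ asc xs)
    = (\<Sum>xs\<in>permutations_of_set S. \<Sum>j | j < length xs \<and> sorted (take (Suc j) xs). (t - 1) ^ j * t ^ asc (drop (Suc j) xs))"
    using ne by (intro sum.cong refl power_asc_eq_sum_increasing_prefixes) (auto simp: permutations_of_set_def)
  also have "\<dots> = (\<Sum>(xs, j)\<in>L. (t - 1) ^ j * t ^ asc (drop (Suc j) xs))"
    unfolding L_def by (rule sum.Sigma) auto
  \<comment> \<open>\<open>F\<close> collects the entries after the prefix. Conversely the prefix is
    recovered as the increasing arrangement of \<open>S - F\<close>, and \<open>j\<close> is its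
    length minus one.\<close>
  also have "\<dots> = (\<Sum>(F, xs)\<in>R. t ^ asc xs * (t - 1) ^ (card (S - F) - 1))"
  proof (rule sum.reindex_bij_witness[where
        i = "\<lambda>(F, ys). (sorted_list_of_set (S - F) @ ys, card (S - F) - 1)" and
        j = "\<lambda>(xs, j). (set (drop (Suc j) xs), drop (Suc j) xs)"])
    fix p assume "p \<in> L"
    then obtain xs j where p: "p = (xs, j)" and xs: "set xs = S" "distinct xs"
      and j: "j < length xs" "sorted (take (Suc j) xs)"
      unfolding L_def permutations_of_set_def by auto
    have disj: "set (take (Suc j) xs) \<inter> set (drop (Suc j) xs) = {}"
      using xs set_take_disj_set_drop_if_distinct by blast
    have un: "set (take (Suc j) xs) \<union> set (drop (Suc j) xs) = S"
      using xs by (metis append_take_drop_id set_append)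
    have SF: "S - set (drop (Suc j) xs) = set (take (Suc j) xs)" using disj un by blast
    have c: "card (set (take (Suc j) xs)) = Suc j" using xs j by (simp add: distinct_card)
    have s: "sorted_list_of_set (set (take (Suc j) xs)) = take (Suc j) xs"
      using xs j by (simp add: sorted_list_of_set.idem_if_sorted_distinct)
    show "(case case p of (xs, j) \<Rightarrow> (set (drop (Suc j) xs), drop (Suc j) xs) of
         (F, ys) \<Rightarrow> (sorted_list_of_set (S - F) @ ys, card (S - F) - 1)) = p"
      using SF c s p by simp
    have "set (drop (Suc j) xs) \<noteq> S" using SF c by auto
    then show "(case p of (xs, j) \<Rightarrow> (set (drop (Suc j) xs), drop (Suc j) xs)) \<in> R"
      using un xs p unfolding R_def permutations_of_set_def by auto
    show "(case case p of (xs, j) \<Rightarrow> (set (drop (Suc j) xs), drop (Suc j) xs) of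
         (F, xs) \<Rightarrow> t ^ asc xs * (t - 1) ^ (card (S - F) - 1)) =
         (case p of (xs, j) \<Rightarrow> (t - 1) ^ j * t ^ asc (drop (Suc j) xs))"
      using SF c p by simp
  next
    fix p assume "p \<in> R"
    then obtain F ys where p: "p = (F, ys)" and F: "F \<subset> S" and ys: "set ys = F" "distinct ys"
      unfolding R_def permutations_of_set_def by auto
    have "S - F \<noteq> {}" using F by blast
    then have "card (S - F) \<noteq> 0" using fin by simp
    then have c: "Suc (card (S - F) - 1) = card (S - F)" by simp
    show "(case case p of (F, ys) \<Rightarrow> (sorted_list_of_set (S - F) @ ys, card (S - F) - 1) of
         (xs, j) \<Rightarrow> (set (drop (Suc j) xs), drop (Suc j) xs)) = p"
      using p ys c by simp
    show "(case p of (F, ys) \<Rightarrow> (sorted_list_of_set (S - F) @ ys, card (S - F) - 1)) \<in> L"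
      using p ys c F fin unfolding L_def permutations_of_set_def by auto
  qed
  also have "\<dots> = (\<Sum>F | F \<subset> S. \<Sum>xs\<in>permutations_of_set F. t ^ asc xs * (t - 1) ^ (card (S - F) - 1))"
    unfolding R_def using fin
    by (intro sum.Sigma[symmetric]) (auto intro: finite_subset[of _ "Pow S"])
  finally show ?thesis by (simp add: sum_distrib_right)
qed

subsection \<open>Counting chains\<close>

text \<open>Applied to a whole chain and also to a chain whose top has been removed; in both cases
  the largest member becomes the new ground set.\<close>

lemma cchain_top:
  assumes fin: "finite E" and Z: "cchain E Z" and A: "A \<subseteq> Z" "({}, 0) \<in> A"
  obtains F a where "(F, a) \<in> A" "F \<subseteq> E" "cchain F A" "\<And>G b. (G, b) \<in> A \<Longrightarrow> G \<subseteq> F"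
proof -
  obtain F a where F: "(F, a) \<in> A" "\<And>G b. (G, b) \<in> A \<Longrightarrow> G \<subseteq> F"
    using cchain_maximal[OF fin Z A(1)] A(2) by blast
  have "F \<subseteq> E" using cchain_subset[OF Z] F(1) A(1) by blast
  moreover have "cchain F A"
    unfolding cchain_def
  proof (intro conjI ballI)
    show "fst ` A \<subseteq> Pow F" using F(2) by fastforce
    show "p = q \<or> cprec p q \<or> cprec q p" if "p \<in> A" "q \<in> A" for p q
      using cchain_comparable[OF Z] that A(1) by blast
  qed (fact A(2))
  ultimately show ?thesis using that F by blast
qed

lemma cchain_mono: "F \<subseteq> E \<Longrightarrow> cchain F Z \<Longrightarrow> cchain E Z"
  unfolding cchain_def by (meson Pow_mono subset_trans)

lemma cchain_rank_le_card:
  assumes "cchain E Z" "(F, a) \<in> Z"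
  shows "a \<le> card F"
  by (rule cchain_cases[OF assms(1) cchain_empty[OF assms(1)] assms(2)]) auto

lemma finite_cchains:
  assumes "finite E"
  shows "finite {Z. cchain E Z}"
proof (rule finite_subset)
  show "{Z. cchain E Z} \<subseteq> Pow (Pow E \<times> {..card E})"
  proof clarify
    fix Z F a assume Z: "cchain E Z" and F: "(F, a) \<in> Z"
    have "F \<subseteq> E" using cchain_subset[OF Z F] .
    moreover have "a \<le> card E"
      using cchain_rank_le_card[OF Z F] card_mono[OF assms \<open>F \<subseteq> E\<close>] by simp
    ultimately show "F \<in> Pow E \<and> a \<in> {..card E}" by simp
  qed
  show "finite (Pow (Pow E \<times> {..card E}))" using assms by simp
qed

text \<open>The second component is determined by the first; it is carried along as the exponent of
  \<open>t\<close>.\<close>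

definition topped_cchains :: "'a set \<Rightarrow> (('a set \<times> nat) set \<times> nat) set" where
  "topped_cchains E = {(Z, a). cchain E Z \<and> (E, a) \<in> Z}"

lemma finite_topped_cchains:
  assumes "finite E"
  shows "finite (topped_cchains E)"
proof (rule finite_subset)
  show "topped_cchains E \<subseteq> {Z. cchain E Z} \<times> {..card E}"
    unfolding topped_cchains_def by (auto dest: cchain_rank_le_card)
qed (simp add: finite_cchains[OF assms])

lemma topped_cchains_empty: "topped_cchains {} = {({({}, 0)}, 0)}"
proof (intro equalityI subrelI)
  fix Z :: "('a set \<times> nat) set" and a assume "(Z, a) \<in> topped_cchains {}"
  then have Z: "cchain {} Z" and a: "({}, a) \<in> Z" unfolding topped_cchains_def by auto
  have "p = ({}, 0)" if "p \<in> Z" for p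
  proof -
    obtain F b where p: "p = (F, b)" by (cases p)
    then have "F = {}" using cchain_subset[OF Z] that by blast
    moreover have "b = 0" using cchain_rank_le_card[OF Z] that p \<open>F = {}\<close> by fastforce
    ultimately show ?thesis using p by simp
  qed
  then show "(Z, a) \<in> {({({}, 0)}, 0)}" using a cchain_empty[OF Z] by blast
qed (auto simp: topped_cchains_def cchain_def)

text \<open>The range of \<open>d\<close> says exactly that \<open>(F, a)\<close> precedes
  \<open>(E, a + d)\<close>. Lower members follow because the gap inequalities add up along the
  chain.\<close>

lemma cchain_insert_top:
  assumes fin: "finite E" and Z: "cchain F Z" "(F, a) \<in> Z" and FE: "F \<subset> E"
    and d: "d \<in> {1..<card (E - F)}"
  shows "cchain E (insert (E, a + d) Z)"
proof -
  have fF: "finite F" using FE fin finite_subset by blast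
  have cF: "card (E - F) = card E - card F" "card F \<le> card E"
    using FE fin fF by (auto simp: card_Diff_subset intro: card_mono)
  have top: "cprec p (E, a + d)" if p: "p \<in> Z" for p
  proof -
    obtain G b where p': "p = (G, b)" by (cases p)
    have G: "(G, b) \<in> Z" using p p' by simp
    have "G \<subseteq> F" using cchain_subset[OF Z(1) G] .
    have "b \<le> a \<and> a + card G \<le> b + card F"
      by (rule cchain_cases[OF Z(1) G Z(2)]) (use \<open>G \<subseteq> F\<close> in auto)
    then show ?thesis using \<open>G \<subseteq> F\<close> FE d cF unfolding p' cprec_def by auto
  qed
  show ?thesis
    unfolding cchain_def
  proof (intro conjI ballI)
    show "fst ` insert (E, a + d) Z \<subseteq> Pow E"
      using cchain_subset[OF Z(1)] FE by fastforce
    show "({}, 0) \<in> insert (E, a + d) Z" using cchain_empty[OF Z(1)] by blast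
    fix p q assume "p \<in> insert (E, a + d) Z" "q \<in> insert (E, a + d) Z"
    then show "p = q \<or> cprec p q \<or> cprec q p"
      using top cchain_comparable[OF Z(1)] by blast
  qed
qed

lemma cchain_top_unique:
  assumes "cchain F Z" "(F, a) \<in> Z" "cchain G Z" "(G, b) \<in> Z"
  shows "F = G" and "a = b"
proof -
  show "F = G" using cchain_subset assms by (metis subset_antisym)
  then show "a = b" using cchain_cases[OF assms(1,2,4)] by (metis psubset_eq)
qed

text \<open>Removing the top \<open>(E, c)\<close> leaves a chain with top \<open>(F, a)\<close>,
  where \<open>F\<close> is a proper subset and the increment \<open>d = c - a\<close> is the only
  other datum. As \<open>E\<close> is nonempty, the pair \<open>({}, 0)\<close> survives the
  removal.\<close>

lemma sum_topped_cchains_rec: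
  fixes t :: real
  assumes fin: "finite E" and ne: "E \<noteq> {}"
  shows "(\<Sum>(Z, a)\<in>topped_cchains E. t ^ a)
    = (\<Sum>F | F \<subset> E. (\<Sum>(Z, a)\<in>topped_cchains F. t ^ a) * (\<Sum>d = 1..<card (E - F). t ^ d))"
proof -
  define R where "R = (SIGMA F : {F. F \<subset> E}. topped_cchains F \<times> {1..<card (E - F)})"
  define f where "f = (\<lambda>(F :: 'a set, (Z, a), d :: nat). (insert (E, a + d) Z, a + d))"
  have finR: "finite {F. F \<subset> E}" using fin by (auto intro: finite_subset[of _ "Pow E"])
  have finT: "finite (topped_cchains F)" if "F \<subset> E" for F
    using finite_topped_cchains finite_subset fin that by (metis psubset_imp_subset)
  have "bij_betw f R (topped_cchains E)"
  proof (rule bij_betw_imageI)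
    show "inj_on f R"
    proof (rule inj_onI)
      fix p q assume pR: "p \<in> R" and qR: "q \<in> R" and eq: "f p = f q"
      obtain F Z a d where p: "p = (F, (Z, a), d)" by (metis surj_pair)
      obtain F' Z' a' d' where q: "q = (F', (Z', a'), d')" by (metis surj_pair)
      have Z: "cchain F Z" "(F, a) \<in> Z" "F \<subset> E" and Z': "cchain F' Z'" "(F', a') \<in> Z'" "F' \<subset> E"
        using pR qR unfolding p q R_def topped_cchains_def by auto
      have pair: "(insert (E, a + d) Z, a + d) = (insert (E, a' + d') Z', a' + d')"
        using eq unfolding p q f_def split .
      note ins = arg_cong[OF pair, of fst, unfolded fst_conv]
        and sum = arg_cong[OF pair, of snd, unfolded snd_conv]
      \<comment> \<open>The new top is absent from both smaller chains, so it can be cancelled from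
        the equality of the enlarged ones.\<close>
      have "(E, a + d) \<notin> Z" using cchain_subset[OF Z(1)] Z(3) by blast
      moreover have "(E, a + d) \<notin> Z'" using cchain_subset[OF Z'(1)] Z'(3) by blast
      ultimately have "Z = Z'" using insert_ident[of "(E, a + d)" Z Z'] ins[folded sum] by simp
      then have "F = F'" "a = a'" using cchain_top_unique[OF Z(1,2)] Z'(1,2) by simp_all
      then show "p = q" using p q sum \<open>Z = Z'\<close> by simp
    qed
    show "f ` R = topped_cchains E"
    proof (intro equalityI subsetI)
      fix w assume "w \<in> f ` R"
      then obtain p where p: "p \<in> R" "w = f p" by blast
      obtain F Z a d where p': "p = (F, (Z, a), d)" by (metis surj_pair)
      have Z: "cchain F Z" "(F, a) \<in> Z" "F \<subset> E" "d \<in> {1..<card (E - F)}"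
        using p(1) unfolding p' R_def topped_cchains_def by auto
      show "w \<in> topped_cchains E"
        using cchain_insert_top[OF fin Z] unfolding p(2) p' topped_cchains_def f_def by simp
    next
      fix w assume w: "w \<in> topped_cchains E"
      obtain W c where wW: "w = (W, c)" by (cases w)
      have W: "cchain E W" "(E, c) \<in> W" using w wW unfolding topped_cchains_def by auto
      define Z where "Z = W - {(E, c)}"
      have "Z \<subseteq> W" "({}, 0) \<in> Z" unfolding Z_def using cchain_empty[OF W(1)] ne by auto
      then obtain F a where F: "(F, a) \<in> Z" "F \<subseteq> E" "cchain F Z"
        using cchain_top[OF fin W(1)] by metis
      have FW: "(F, a) \<in> W" "(F, a) \<noteq> (E, c)" using F(1) unfolding Z_def by auto
      have c: "F \<subset> E \<and> a < c \<and> c + card F < a + card E"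
        by (rule cchain_cases[OF W(1) FW(1) W(2)]) (use FW F(2) in auto)
      have "card (E - F) = card E - card F"
        using fin F(2) by (meson card_Diff_subset finite_subset)
      then have "(F, (Z, a), c - a) \<in> R"
        using F c unfolding R_def topped_cchains_def by auto
      moreover have "f (F, (Z, a), c - a) = w"
        using c W(2) unfolding f_def wW Z_def by auto
      ultimately show "w \<in> f ` R" by force
    qed
  qed
  then have "(\<Sum>(Z, a)\<in>topped_cchains E. t ^ a) = (\<Sum>p\<in>R. (case f p of (Z, a) \<Rightarrow> t ^ a))"
    by (simp add: sum.reindex_bij_betw)
  also have "\<dots> = (\<Sum>(F, p)\<in>R. t ^ snd (fst p) * t ^ snd p)"
    unfolding f_def by (intro sum.cong refl) (auto simp: power_add)
  also have "\<dots> = (\<Sum>F | F \<subset> E. \<Sum>p\<in>topped_cchains F \<times> {1..<card (E - F)}. t ^ snd (fst p) * t ^ snd p)"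
    unfolding R_def
    using finR finT by (subst sum.Sigma) auto
  also have "\<dots> = (\<Sum>F | F \<subset> E. (\<Sum>(Z, a)\<in>topped_cchains F. t ^ a) * (\<Sum>d = 1..<card (E - F). t ^ d))"
    by (intro sum.cong refl) (simp add: sum_product sum.cartesian_product case_prod_unfold)
  finally show ?thesis .
qed

text \<open>Sorts the chains on \<open>E\<close> by their unique largest member, which need not be
  \<open>E\<close> itself.\<close>

lemma bij_betw_topped_cchains:
  assumes fin: "finite E"
  shows "bij_betw (\<lambda>(F, (Z, a)). Z) (SIGMA F : Pow E. topped_cchains F) {Z. cchain E Z}"
proof (rule bij_betw_imageI)
  show "inj_on (\<lambda>(F, (Z, a)). Z) (SIGMA F : Pow E. topped_cchains F)"
  proof (rule inj_onI)
    fix p q assume pq: "p \<in> (SIGMA F : Pow E. topped_cchains F)" "q \<in> (SIGMA F : Pow E. topped_cchains F)"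
      and eq: "(case p of (F, (Z, a)) \<Rightarrow> Z) = (case q of (F, (Z, a)) \<Rightarrow> Z)"
    obtain F Z a where p: "p = (F, (Z, a))" by (metis surj_pair)
    obtain G W b where q: "q = (G, (W, b))" by (metis surj_pair)
    have "W = Z" using eq unfolding p q by simp
    then have "cchain F Z" "(F, a) \<in> Z" "cchain G Z" "(G, b) \<in> Z"
      using pq unfolding p q topped_cchains_def by simp_all
    from cchain_top_unique[OF this] show "p = q" using \<open>W = Z\<close> p q by simp
  qed
  show "(\<lambda>(F, (Z, a)). Z) ` (SIGMA F : Pow E. topped_cchains F) = {Z. cchain E Z}"
  proof (intro equalityI subsetI)
    fix Z assume "Z \<in> (\<lambda>(F, (Z, a)). Z) ` (SIGMA F : Pow E. topped_cchains F)"
    then obtain F a where "F \<subseteq> E" "(Z, a) \<in> topped_cchains F" by auto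
    then show "Z \<in> {Z. cchain E Z}" unfolding topped_cchains_def by (auto intro: cchain_mono)
  next
    fix Z assume "Z \<in> {Z. cchain E Z}"
    then have Z: "cchain E Z" by simp
    obtain F a where "(F, a) \<in> Z" "F \<subseteq> E" "cchain F Z"
      by (rule cchain_top[OF fin Z subset_refl cchain_empty[OF Z]])
    then have "(F, (Z, a)) \<in> (SIGMA F : Pow E. topped_cchains F)"
      unfolding topped_cchains_def by simp
    then show "Z \<in> (\<lambda>(F, (Z, a)). Z) ` (SIGMA F : Pow E. topped_cchains F)"
      by (rule rev_image_eqI) simp
  qed
qed

section \<open>From chains to nested matroids and permutations\<close>

lemma bij_betw_chain_indep:
  assumes "finite E"
  shows "bij_betw (chain_indep E) {Z. cchain E Z} {I. nested_matroid E I \<and> loopfree E I}"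
proof (rule bij_betw_byWitness[where f' = "flat_ranks E"])
  show "\<forall>Z\<in>{Z. cchain E Z}. flat_ranks E (chain_indep E Z) = Z"
    using flat_ranks_chain_indep[OF assms] by simp
  show "\<forall>I\<in>{I. nested_matroid E I \<and> loopfree E I}. chain_indep E (flat_ranks E I) = I"
    using chain_indep_flat_ranks unfolding nested_matroid_def by blast
  show "chain_indep E ` {Z. cchain E Z} \<subseteq> {I. nested_matroid E I \<and> loopfree E I}"
    using nested_chain_indep[OF assms] loopfree_chain_indep[OF assms] by blast
  show "flat_ranks E ` {I. nested_matroid E I \<and> loopfree E I} \<subseteq> {Z. cchain E Z}"
    using cchain_flat_ranks by blast
qed

text \<open>\<open>F\<close> is the largest cyclic flat. The coloops in \<open>E - F\<close> each
  contribute a factor \<open>t\<close>, which becomes the factor \<open>fps_exp t\<close> of the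
  generating function.\<close>

lemma sum_nested_eq_sum_topped_cchains:
  fixes t :: real
  assumes fin: "finite E"
  shows "(\<Sum>I | nested_matroid E I \<and> loopfree E I. t ^ rank_of I E)
    = (\<Sum>F\<in>Pow E. (\<Sum>(Z, a)\<in>topped_cchains F. t ^ a) * t ^ card (E - F))"
proof -
  have "(\<Sum>I | nested_matroid E I \<and> loopfree E I. t ^ rank_of I E)
    = (\<Sum>Z | cchain E Z. t ^ rank_of (chain_indep E Z) E)"
    by (rule sum.reindex_bij_betw[OF bij_betw_chain_indep[OF fin], symmetric])
  also have "\<dots> = (\<Sum>p\<in>(SIGMA F : Pow E. topped_cchains F).
      t ^ rank_of (chain_indep E (case p of (F, (Z, a)) \<Rightarrow> Z)) E)"
    by (rule sum.reindex_bij_betw[OF bij_betw_topped_cchains[OF fin], symmetric])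
  also have "\<dots> = (\<Sum>(F, p)\<in>(SIGMA F : Pow E. topped_cchains F).
      t ^ snd p * t ^ card (E - F))"
  proof (intro sum.cong refl)
    fix p assume p: "p \<in> (SIGMA F : Pow E. topped_cchains F)"
    obtain F Z a where p': "p = (F, (Z, a))" by (metis surj_pair)
    have F: "F \<subseteq> E" "cchain F Z" "(F, a) \<in> Z" using p p' unfolding topped_cchains_def by auto
    then have "cchain E Z" using cchain_mono by blast
    then have "rank_of (chain_indep E Z) E = a + card (E - F)"
      using rank_of_chain_indep_top[OF fin _ F(3)] cchain_subset[OF F(2)] by blast
    then show "t ^ rank_of (chain_indep E (case p of (F, (Z, a)) \<Rightarrow> Z)) E =
      (case p of (F, p) \<Rightarrow> t ^ snd p * t ^ card (E - F))"
      unfolding p' by (simp add: power_add)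
  qed
  also have "\<dots> = (\<Sum>F\<in>Pow E. \<Sum>p\<in>topped_cchains F. t ^ snd p * t ^ card (E - F))"
    using fin finite_topped_cchains by (subst sum.Sigma) (auto dest: finite_subset)
  finally show ?thesis by (simp add: sum_distrib_right case_prod_unfold)
qed

lemma sum_nested_eq_sum_asc:
  fixes t :: real and E :: "'a::linorder set"
  assumes fin: "finite E" and ne: "E \<noteq> {}" and t: "t \<noteq> 1"
  shows "(\<Sum>I | nested_matroid E I \<and> loopfree E I. t ^ rank_of I E)
    = (\<Sum>xs\<in>permutations_of_set E. t ^ Suc (asc xs))"
proof -
  define G where "G = Abs_fps (\<lambda>n. if n = 0 then 0 else (\<Sum>d = 1..<n. t ^ d) / fact n)"
  define K where "K = Abs_fps (\<lambda>n. if n = 0 then 0 else (t - 1) ^ (n - 1) / fact n)"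
  have q: "(\<Sum>(Z, a)\<in>topped_cchains F. t ^ a) = fact (card F) * inverse (1 - G) $ card F"
    if "finite F" for F :: "'a set"
    by (rule set_renewal_fps[where h = "\<lambda>F. \<Sum>(Z, a)\<in>topped_cchains F. t ^ a",
          OF _ sum_topped_cchains_rec that G_def]) (auto simp: topped_cchains_empty)
  have p: "(\<Sum>xs\<in>permutations_of_set E. t ^ asc xs) = fact (card E) * inverse (1 - K) $ card E"
    by (rule set_renewal_fps[where h = "\<lambda>F. \<Sum>xs\<in>permutations_of_set F. t ^ asc xs",
          OF _ sum_power_asc_rec fin K_def]) auto
  have "(\<Sum>I | nested_matroid E I \<and> loopfree E I. t ^ rank_of I E)
    = (\<Sum>F\<in>Pow E. (fact (card F) * inverse (1 - G) $ card F)
        * (fact (card (E - F)) * fps_exp t $ card (E - F)))"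
    unfolding sum_nested_eq_sum_topped_cchains[OF fin]
    using fin finite_subset q by (intro sum.cong refl) auto
  also have "\<dots> = fact (card E) * (inverse (1 - G) * fps_exp t) $ card E"
    by (rule sum_Pow_fps_mult[OF fin])
  \<comment> \<open>Since \<open>E\<close> is nonempty, the constant \<open>1 - fps_const t\<close>
    does not reach this coefficient. The surviving factor \<open>t\<close> is the shift between rank
    and number of ascents.\<close>
  also have "\<dots> = t * (fact (card E) * inverse (1 - K) $ card E)"
    unfolding nested_eulerian_fps[OF t G_def K_def] using fin ne by simp
  finally show ?thesis unfolding p[symmetric] by (simp add: sum_distrib_left)
qed

theorem theorem4p5:
  fixes n r :: nat
  assumes "n \<ge> 1" and "1 \<le> r" and "r \<le> n"
  shows "num_loopfree_nested r n = eulerian (r - 1) n"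
proof -
  let ?N = "{I. nested_matroid {1..n} I \<and> loopfree {1..n} I}"
  have "finite ?N"
    by (rule finite_subset[of _ "Pow (Pow {1..n})"]) (auto simp: nested_matroid_def matroid_def)
  then have "card {I \<in> ?N. rank_of I {1..n} = r}
    = card {xs \<in> permutations_of_set {1..n}. Suc (asc xs) = r}"
    by (rule card_level_eqI) (use assms sum_nested_eq_sum_asc[of "{1..n}"] in auto)
  moreover have "{I \<in> ?N. rank_of I {1..n} = r}
    = {I. nested_matroid {1..n} I \<and> loopfree {1..n} I \<and> rank_of I {1..n} = r}" by blast
  \<comment> \<open>Positivity of \<open>r\<close> makes the truncated subtraction
    \<open>r - 1\<close> harmless.\<close>
  moreover have "{xs \<in> permutations_of_set {1..n}. Suc (asc xs) = r}
    = {xs \<in> permutations_of_set {1..n}. asc xs = r - 1}" using assms by auto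
  ultimately show ?thesis unfolding num_loopfree_nested_def eulerian_eq_card_asc by simp
qed

end
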